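(* Let $K$ be a field and let $\mathcal P$ be a collection of cells of $\mathbb N^2$. Then $I_{\mathcal P}$ is a prime ideal if and only if $I_{\mathcal P}=L_{\mathcal P}$.
   Context: Order $\mathbb N^2$ by $(i,j)\le(k,l)$ iff $i\le k$ and $j\le l$; for $a\le b$ let $[a,b]=\{c: a\le c\le b\}$. For $a=(i,j)$, $b=(k,l)$ with $i<k$, $j<l$ the interval $[a,b]$ is proper, with anti-diagonal corners $c=(k,j)$, $d=(i,l)$. A cell with lower left corner $a$ is $C=[a,a+(1,1)]$, with set of four vertices $V(C)$. A cell with lower left corner $(r,s)$ belongs to $[(i,j),(k,l)]$ if $i\le r\le k-1$, $j\le s\le l-1$. A collection of cells $\mathcal P$ is a finite set of cells; $V(\mathcal P)=\bigcup_{C\in\mathcal P}V(C)$. A proper interval $[a,b]$ is an inner interval of $\mathcal P$ if all cells belonging to it are in $\mathcal P$; then $f_{a,b}=x_ax_b-x_cx_d$ is an inner 2-minor. $S=K[x_a:a\in V(\mathcal P)]$ and $I_{\mathcal P}\subset S$ is the ideal generated by all inner 2-minors of $\mathcal P$. Definition of $L_{\mathcal P}$: a vertex in $V(\mathcal P)$ is free if it is not the lower left corner of any cell of $\mathcal P$; $F(\mathcal P)$ is the set of free vertices. Let $T=K[y_c^{\pm1}: c\in F(\mathcal P)]$. Define Laurent monomials $u_a\in T$, $a\in V(\mathcal P)$, recursively: $u_a=y_a$ if $a$ is free; if $a=(i,j)$ is not free, then $u_a=u_bu_cu_d^{-1}$ where $b=(i+1,j)$, $c=(i,j+1)$, $d=(i+1,j+1)$.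 Let $\psi:S\to T$ be the $K$-algebra homomorphism $x_a\mapsto u_a$, and $L_{\mathcal P}=\ker\psi$. *)

theory Defs
  imports "HOL-Algebra.QuotRing" "HOL-Library.Poly_Mapping"
begin

section \<open>Collections of cells\<close>

type_synonym point = "nat \<times> nat"

text \<open>The order on pairs is the componentwise one, so an interval is a product of two
  integer intervals. (No order instance on pairs is used, since the libraries offer
  both the componentwise and the lexicographic one.)\<close>

definition interval :: "point \<Rightarrow> point \<Rightarrow> point set" where
  "interval a b = {fst a..fst b} \<times> {snd a..snd b}"

text \<open>A cell is an interval, hence literally the set of its four vertices: \<open>V(C) = C\<close>.\<close>

definition cell :: "point \<Rightarrow> point set" where
  "cell a = interval a (fst a + 1, snd a + 1)"

definition cell_collection :: "point set set \<Rightarrow> bool" where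
  "cell_collection P \<longleftrightarrow> finite P \<and> P \<subseteq> range cell"

definition vertices :: "point set set \<Rightarrow> point set" where
  "vertices P = \<Union>P"

definition proper_interval :: "point \<Rightarrow> point \<Rightarrow> bool" where
  "proper_interval a b \<longleftrightarrow> fst a < fst b \<and> snd a < snd b"

definition cells_of_interval :: "point \<Rightarrow> point \<Rightarrow> point set set" where
  "cells_of_interval a b =
     {cell (r, s) | r s. fst a \<le> r \<and> r \<le> fst b - 1 \<and> snd a \<le> s \<and> s \<le> snd b - 1}"

definition inner_interval :: "point set set \<Rightarrow> point \<Rightarrow> point \<Rightarrow> bool" where
  "inner_interval P a b \<longleftrightarrow> proper_interval a b \<and> cells_of_interval a b \<subseteq> P"

definition free_vertices :: "point set set \<Rightarrow> point set" where
  "free_vertices P = {a \<in> vertices P. \<not> (\<exists>C\<in>P. C = cell a)}"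

section \<open>Polynomial and Laurent polynomial rings\<close>

text \<open>A polynomial is a finitely supported map from exponent vectors to coefficients, an
  exponent vector being a finitely supported map from variables to exponents. With exponents
  of type \<^typ>\<open>nat\<close> this gives the polynomial ring \<open>K[x\<^sub>a : a \<in> V]\<close>, with exponents of
  type \<^typ>\<open>int\<close> the Laurent polynomial ring \<open>K[x\<^sub>a\<^sup>\<plusminus>\<^sup>1 : a \<in> V]\<close>.\<close>

type_synonym 'k mpoly = "(point \<Rightarrow>\<^sub>0 nat) \<Rightarrow>\<^sub>0 'k"
type_synonym 'k laurent = "(point \<Rightarrow>\<^sub>0 int) \<Rightarrow>\<^sub>0 'k"

definition mpoly_ring ::
    "'v set \<Rightarrow> (('v \<Rightarrow>\<^sub>0 'e::comm_monoid_add) \<Rightarrow>\<^sub>0 'k::comm_ring_1) ring" where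
  "mpoly_ring V = \<lparr>carrier = {p. \<forall>m\<in>Poly_Mapping.keys p. Poly_Mapping.keys m \<subseteq> V},
     monoid.mult = (*), one = 1, zero = 0, add = (+)\<rparr>"

definition var :: "'v \<Rightarrow> ('v \<Rightarrow>\<^sub>0 'e::comm_semiring_1) \<Rightarrow>\<^sub>0 'k::comm_ring_1" where
  "var a = Poly_Mapping.single (Poly_Mapping.single a 1) 1"

abbreviation const :: "'k \<Rightarrow> ('v \<Rightarrow>\<^sub>0 'e::comm_monoid_add) \<Rightarrow>\<^sub>0 'k::comm_ring_1" where
  "const c \<equiv> Poly_Mapping.single 0 c"

abbreviation S_ring :: "point set set \<Rightarrow> 'k::field mpoly ring" where
  "S_ring P \<equiv> mpoly_ring (vertices P)"

abbreviation T_ring :: "point set set \<Rightarrow> 'k::field laurent ring" where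
  "T_ring P \<equiv> mpoly_ring (free_vertices P)"

section \<open>The ideal of inner 2-minors\<close>

definition minor :: "point \<Rightarrow> point \<Rightarrow> 'k::field mpoly" where
  "minor a b = var a * var b - var (fst b, snd a) * var (fst a, snd b)"

definition I_ideal :: "point set set \<Rightarrow> 'k::field mpoly set" where
  "I_ideal P = Idl\<^bsub>S_ring P\<^esub> {minor a b | a b. inner_interval P a b}"

section \<open>The lattice ideal\<close>

lemma inj_cell: "inj cell"
proof (rule injI)
  fix a b :: point
  assume eq: "cell a = cell b"
  have "a \<in> cell a" "b \<in> cell b"
    by (auto simp: cell_def interval_def mem_Times_iff)
  then have "a \<in> cell b" "b \<in> cell a"
    unfolding eq by simp_all
  then show "a = b"
    by (auto simp: cell_def interval_def mem_Times_iff prod_eq_iff)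
qed

text \<open>\<open>u_exp P a\<close> is the exponent vector of the Laurent monomial \<open>u\<^sub>a\<close>. The guard
  \<^term>\<open>finite P\<close> only serves termination; the values outside \<open>V(P)\<close> are irrelevant.\<close>

function u_exp :: "point set set \<Rightarrow> point \<Rightarrow> (point \<Rightarrow>\<^sub>0 int)" where
  "u_exp P (i, j) =
     (if finite P \<and> cell (i, j) \<in> P
      then u_exp P (i + 1, j) + u_exp P (i, j + 1) - u_exp P (i + 1, j + 1)
      else Poly_Mapping.single (i, j) 1)"
  by pat_completeness auto
termination
proof (relation "measure (\<lambda>(P, a). card {c. cell c \<in> P \<and> fst a \<le> fst c \<and> snd a \<le> snd c})",
    goal_cases)
  have less: "card {c. cell c \<in> P \<and> k \<le> fst c \<and> l \<le> snd c}
      < card {c. cell c \<in> P \<and> i \<le> fst c \<and> j \<le> snd c}"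
    if P: "finite P \<and> cell (i, j) \<in> P" and le: "i \<le> k" "j \<le> l" "(i, j) \<noteq> (k, l)"
    for P :: "point set set" and i j k l
  proof (rule psubset_card_mono)
    have "finite (cell -` P)"
      using P inj_cell by (simp add: finite_vimageI)
    then show "finite {c. cell c \<in> P \<and> i \<le> fst c \<and> j \<le> snd c}"
      by (rule rev_finite_subset) auto
    have "(i, j) \<in> {c. cell c \<in> P \<and> i \<le> fst c \<and> j \<le> snd c}"
      "(i, j) \<notin> {c. cell c \<in> P \<and> k \<le> fst c \<and> l \<le> snd c}"
      using P le by auto
    moreover have "{c. cell c \<in> P \<and> k \<le> fst c \<and> l \<le> snd c}
        \<subseteq> {c. cell c \<in> P \<and> i \<le> fst c \<and> j \<le> snd c}"
      using le by auto
    ultimately show "{c. cell c \<in> P \<and> k \<le> fst c \<and> l \<le> snd c}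
        \<subset> {c. cell c \<in> P \<and> i \<le> fst c \<and> j \<le> snd c}"
      by blast
  qed
  {
    case 1 show ?case by simp
  next
    case (2 P i j) then show ?case using less[of P i j "i + 1" j] by simp
  next
    case (3 P i j) then show ?case using less[of P i j i "j + 1"] by simp
  next
    case (4 P i j) then show ?case using less[of P i j "i + 1" "j + 1"] by simp
  }
qed

declare u_exp.simps [simp del]

definition u :: "point set set \<Rightarrow> point \<Rightarrow> 'k::field laurent" where
  "u P a = Poly_Mapping.single (u_exp P a) 1"

definition psi :: "point set set \<Rightarrow> 'k::field mpoly \<Rightarrow> 'k laurent" where
  "psi P p = (\<Sum>m\<in>Poly_Mapping.keys p.
     const (Poly_Mapping.lookup p m) *
       (\<Prod>a\<in>Poly_Mapping.keys m. u P a ^ Poly_Mapping.lookup m a))"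

definition L_ideal :: "point set set \<Rightarrow> 'k::field mpoly set" where
  "L_ideal P = a_kernel (S_ring P) (T_ring P) (psi P)"

subsection \<open>Agreement with the recursive description of \<open>u\<close> and \<open>\<psi>\<close>\<close>

lemma u_free: "a \<in> free_vertices P \<Longrightarrow> u P a = var a"
  by (cases a) (auto simp: u_def var_def free_vertices_def u_exp.simps)

lemma u_nonfree:
  assumes "cell_collection P" "cell (i, j) \<in> P"
  shows "u P (i, j) = u P (i + 1, j) * u P (i, j + 1) *
           Poly_Mapping.single (- u_exp P (i + 1, j + 1)) 1"
  using assms by (subst u_def, subst u_exp.simps)
    (simp add: u_def mult_single cell_collection_def)

lemma u_inverse: "u P a * Poly_Mapping.single (- u_exp P a) 1 = 1"
  by (simp add: u_def mult_single)

lemma mpoly_ring_simps [simp]: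
  "p \<in> carrier (mpoly_ring V) \<longleftrightarrow> (\<forall>m\<in>Poly_Mapping.keys p. Poly_Mapping.keys m \<subseteq> V)"
  "p \<otimes>\<^bsub>mpoly_ring V\<^esub> q = p * q" "\<one>\<^bsub>mpoly_ring V\<^esub> = 1"
  "\<zero>\<^bsub>mpoly_ring V\<^esub> = 0" "p \<oplus>\<^bsub>mpoly_ring V\<^esub> q = p + q"
  by (simp_all add: mpoly_ring_def)

lemma mpoly_ring_closed:
  assumes "p \<in> carrier (mpoly_ring V)" "q \<in> carrier (mpoly_ring V)"
  shows "p + q \<in> carrier (mpoly_ring V)" "p * q \<in> carrier (mpoly_ring V)"
    "- p \<in> carrier (mpoly_ring V)" "p - q \<in> carrier (mpoly_ring V)"
proof -
  show "p + q \<in> carrier (mpoly_ring V)"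
    using assms keys_add[of p q] by auto
  show "p * q \<in> carrier (mpoly_ring V)"
  proof -
    have "Poly_Mapping.keys m \<subseteq> V" if m: "m \<in> Poly_Mapping.keys (p * q)" for m
    proof -
      obtain a b where "m = a + b" "a \<in> Poly_Mapping.keys p" "b \<in> Poly_Mapping.keys q"
        using m keys_mult[of p q] by blast
      then show ?thesis
        using assms keys_add[of a b] by fastforce
    qed
    then show ?thesis by simp
  qed
  show "- p \<in> carrier (mpoly_ring V)"
    using assms by simp
  show "p - q \<in> carrier (mpoly_ring V)"
    using assms keys_diff[of p q] by auto
qed

lemma cring_mpoly_ring:
  "cring (mpoly_ring V :: (('v \<Rightarrow>\<^sub>0 'e::comm_monoid_add) \<Rightarrow>\<^sub>0 'k::comm_ring_1) ring)"
proof (rule cringI)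
  let ?R = "mpoly_ring V :: (('v \<Rightarrow>\<^sub>0 'e) \<Rightarrow>\<^sub>0 'k) ring"
  show "abelian_group ?R"
  proof (rule abelian_groupI)
    fix p q r :: "('v \<Rightarrow>\<^sub>0 'e) \<Rightarrow>\<^sub>0 'k"
    show "p \<oplus>\<^bsub>?R\<^esub> q \<in> carrier ?R" if "p \<in> carrier ?R" "q \<in> carrier ?R"
      using mpoly_ring_closed(1)[OF that] by (simp only: mpoly_ring_simps(5))
    show "\<zero>\<^bsub>?R\<^esub> \<in> carrier ?R" by simp
    show "p \<oplus>\<^bsub>?R\<^esub> q \<oplus>\<^bsub>?R\<^esub> r = p \<oplus>\<^bsub>?R\<^esub> (q \<oplus>\<^bsub>?R\<^esub> r)" by (simp add: add.assoc)
    show "p \<oplus>\<^bsub>?R\<^esub> q = q \<oplus>\<^bsub>?R\<^esub> p" by (simp add: add.commute)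
    show "\<zero>\<^bsub>?R\<^esub> \<oplus>\<^bsub>?R\<^esub> p = p" by simp
    show "\<exists>q\<in>carrier ?R. q \<oplus>\<^bsub>?R\<^esub> p = \<zero>\<^bsub>?R\<^esub>" if "p \<in> carrier ?R"
      by (rule bexI[OF _ mpoly_ring_closed(3)[OF that that]]) simp
  qed
  show "Group.comm_monoid ?R"
  proof (rule comm_monoidI)
    fix p q r :: "('v \<Rightarrow>\<^sub>0 'e) \<Rightarrow>\<^sub>0 'k"
    show "p \<otimes>\<^bsub>?R\<^esub> q \<in> carrier ?R" if "p \<in> carrier ?R" "q \<in> carrier ?R"
      using mpoly_ring_closed(2)[OF that] by (simp only: mpoly_ring_simps(2))
    show "\<one>\<^bsub>?R\<^esub> \<in> carrier ?R" by simp
    show "p \<otimes>\<^bsub>?R\<^esub> q \<otimes>\<^bsub>?R\<^esub> r = p \<otimes>\<^bsub>?R\<^esub> (q \<otimes>\<^bsub>?R\<^esub> r)" by (simp add: mult.assoc)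
    show "p \<otimes>\<^bsub>?R\<^esub> q = q \<otimes>\<^bsub>?R\<^esub> p" by (simp add: mult.commute)
    show "\<one>\<^bsub>?R\<^esub> \<otimes>\<^bsub>?R\<^esub> p = p" by simp
  qed
  fix p q r :: "('v \<Rightarrow>\<^sub>0 'e) \<Rightarrow>\<^sub>0 'k"
  show "(p \<oplus>\<^bsub>?R\<^esub> q) \<otimes>\<^bsub>?R\<^esub> r = p \<otimes>\<^bsub>?R\<^esub> r \<oplus>\<^bsub>?R\<^esub> q \<otimes>\<^bsub>?R\<^esub> r"
    by (simp add: distrib_right)
qed

lemma vertices_cell:
  assumes "cell (i, j) \<in> P"
  shows "(i, j) \<in> vertices P" "(i + 1, j) \<in> vertices P"
    "(i, j + 1) \<in> vertices P" "(i + 1, j + 1) \<in> vertices P"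
proof -
  have "cell (i, j) \<subseteq> vertices P"
    using assms by (auto simp: vertices_def)
  then show "(i, j) \<in> vertices P" "(i + 1, j) \<in> vertices P"
    "(i, j + 1) \<in> vertices P" "(i + 1, j + 1) \<in> vertices P"
    by (auto simp: cell_def interval_def subset_iff)
qed

lemma keys_u_exp:
  "finite P \<Longrightarrow> a \<in> vertices P \<Longrightarrow> Poly_Mapping.keys (u_exp P a) \<subseteq> free_vertices P"
proof (induction P a rule: u_exp.induct)
  case (1 P i j)
  show ?case
  proof (cases "cell (i, j) \<in> P")
    case True
    have "Poly_Mapping.keys (u_exp P (i + 1, j) + u_exp P (i, j + 1) - u_exp P (i + 1, j + 1))
        \<subseteq> Poly_Mapping.keys (u_exp P (i + 1, j)) \<union> Poly_Mapping.keys (u_exp P (i, j + 1)) \<union>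
          Poly_Mapping.keys (u_exp P (i + 1, j + 1))"
      using keys_diff[of "u_exp P (i + 1, j) + u_exp P (i, j + 1)" "u_exp P (i + 1, j + 1)"]
        keys_add[of "u_exp P (i + 1, j)" "u_exp P (i, j + 1)"] by blast
    also have "\<dots> \<subseteq> free_vertices P"
      using True 1 vertices_cell[OF True] by (intro Un_least) simp_all
    finally show ?thesis
      using True 1(4) by (simp add: u_exp.simps[of P i j])
  next
    case False
    then show ?thesis
      using 1(5) by (auto simp: u_exp.simps[of P i j] free_vertices_def)
  qed
qed

lemma u_closed:
  "cell_collection P \<Longrightarrow> a \<in> vertices P \<Longrightarrow> u P a \<in> carrier (T_ring P)"
  using keys_u_exp[of P a] by (simp add: u_def cell_collection_def)

lemma psi_superset:
  assumes "finite A" "Poly_Mapping.keys p \<subseteq> A"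
  shows "psi P p = (\<Sum>m\<in>A. const (Poly_Mapping.lookup p m) *
    (\<Prod>a\<in>Poly_Mapping.keys m. u P a ^ Poly_Mapping.lookup m a))"
  unfolding psi_def using assms
  by (intro sum.mono_neutral_left) (auto simp: in_keys_iff)

lemma psi_add: "psi P (p + q) = psi P p + psi P q"
proof -
  let ?A = "Poly_Mapping.keys p \<union> Poly_Mapping.keys q"
  show ?thesis
    using keys_add[of p q]
    by (simp add: psi_superset[of ?A] lookup_add single_add distrib_right sum.distrib)
qed

lemma psi_sum: "psi P (sum f A) = (\<Sum>x\<in>A. psi P (f x))"
  by (induction A rule: infinite_finite_induct) (simp_all add: psi_add, simp_all add: psi_def)

lemma psi_single: "psi P (Poly_Mapping.single m c) =
    const c * (\<Prod>a\<in>Poly_Mapping.keys m. u P a ^ Poly_Mapping.lookup m a)"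
  by (simp add: psi_def)

lemma psi_const: "psi P (const c) = const c"
  by (simp add: psi_single)

lemma psi_var: "psi P (var a) = u P a"
  by (simp add: var_def psi_single)

lemma monomial_image_add:
  fixes m n :: "point \<Rightarrow>\<^sub>0 nat"
  shows "(\<Prod>a\<in>Poly_Mapping.keys (m + n). u P a ^ Poly_Mapping.lookup (m + n) a) =
    (\<Prod>a\<in>Poly_Mapping.keys m. u P a ^ Poly_Mapping.lookup m a) *
    (\<Prod>a\<in>Poly_Mapping.keys n. u P a ^ Poly_Mapping.lookup n a)"
proof -
  let ?A = "Poly_Mapping.keys m \<union> Poly_Mapping.keys n"
  have *: "(\<Prod>a\<in>Poly_Mapping.keys k. u P a ^ Poly_Mapping.lookup k a) =
      (\<Prod>a\<in>?A. u P a ^ Poly_Mapping.lookup k a)"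
    if "Poly_Mapping.keys k \<subseteq> ?A" for k :: "point \<Rightarrow>\<^sub>0 nat"
    using that by (intro prod.mono_neutral_left) (auto simp: in_keys_iff)
  show ?thesis
    by (subst (1 2 3) *) (use keys_add[of m n] in \<open>auto simp: lookup_add power_add prod.distrib\<close>)
qed

lemma sum_single_keys:
  "p = (\<Sum>m\<in>Poly_Mapping.keys p. Poly_Mapping.single m (Poly_Mapping.lookup p m))"
  by (rule poly_mapping_eqI) (simp add: lookup_sum lookup_single when_def in_keys_iff)

lemma psi_mult:
  fixes p q :: "'k::field mpoly"
  shows "psi P (p * q) = psi P p * psi P q"
proof -
  have single: "psi P (Poly_Mapping.single m c * Poly_Mapping.single n d) =
      psi P (Poly_Mapping.single m c) * psi P (Poly_Mapping.single n d)" for m n and c d :: 'k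
  proof -
    have "const (c * d) = const c * (const d :: 'k laurent)"
      by (simp add: mult_single)
    then show ?thesis
      by (simp only: mult_single[of m c n d] psi_single monomial_image_add mult_ac)
  qed
  let ?p = "\<lambda>m. Poly_Mapping.single m (Poly_Mapping.lookup p m)"
  let ?q = "\<lambda>m. Poly_Mapping.single m (Poly_Mapping.lookup q m)"
  have "psi P (sum ?p (Poly_Mapping.keys p) * sum ?q (Poly_Mapping.keys q)) =
      psi P (sum ?p (Poly_Mapping.keys p)) * psi P (sum ?q (Poly_Mapping.keys q))"
    by (simp only: sum_product psi_sum single)
  then show ?thesis
    by (simp only: sum_single_keys[symmetric])
qed

lemma psi_closed:
  assumes "cell_collection P" "p \<in> carrier (S_ring P)"
  shows "psi P p \<in> carrier (T_ring P)"
proof -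
  have sum: "sum f A \<in> carrier (T_ring P)"
    if "\<And>x. x \<in> A \<Longrightarrow> f x \<in> carrier (T_ring P)"
    for f :: "(point \<Rightarrow>\<^sub>0 nat) \<Rightarrow> 'a laurent" and A
    using that
  proof (induction A rule: infinite_finite_induct)
    case (insert x A)
    then show ?case by (simp only: sum.insert mpoly_ring_closed(1) insert_iff simp_thms)
  qed simp_all
  have power: "q ^ n \<in> carrier (T_ring P)" if "q \<in> carrier (T_ring P)"
    for q :: "'a laurent" and n :: nat
  proof (induction n)
    case (Suc n)
    then show ?case using that by (simp only: power_Suc mpoly_ring_closed(2))
  qed simp
  have prod: "prod f A \<in> carrier (T_ring P)"
    if "\<And>x. x \<in> A \<Longrightarrow> f x \<in> carrier (T_ring P)" for f :: "point \<Rightarrow> 'a laurent" and A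
    using that
  proof (induction A rule: infinite_finite_induct)
    case (insert x A)
    then show ?case by (simp only: prod.insert mpoly_ring_closed(2) insert_iff simp_thms)
  qed simp_all
  have const: "const c \<in> carrier (T_ring P)" for c :: 'a
    by simp
  show ?thesis
    unfolding psi_def using assms
    by (intro sum mpoly_ring_closed(2) const prod power u_closed) auto
qed

lemma psi_ring_hom: "cell_collection P \<Longrightarrow> psi P \<in> ring_hom (S_ring P) (T_ring P)"
  by (rule ring_hom_memI)
    (use psi_closed in \<open>simp_all add: psi_add psi_mult psi_const[of P 1, simplified]\<close>)

end

theory Submission
  imports Defs "HOL-Library.Product_Lexorder"
begin

text \<open>The ideal \<open>L\<^sub>P\<close> is prime because the Laurent polynomial ring is a domain, and it contains
  \<open>I\<^sub>P\<close> because \<open>u\<^sub>a u\<^sub>b = u\<^sub>c u\<^sub>d\<close> propagates from single cells to all inner intervals.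
  Conversely, the minors of single cells rewrite each variable modulo \<open>I\<^sub>P\<close> as a fraction of
  monomials in the free variables. Two monomials with the same image under \<open>\<psi>\<close> hence become
  congruent modulo \<open>I\<^sub>P\<close> after multiplication by a suitable monomial. If \<open>I\<^sub>P\<close> is prime, this
  monomial can be cancelled, since no monomial lies in \<open>L\<^sub>P \<supseteq> I\<^sub>P\<close>; and \<open>L\<^sub>P\<close> is spanned by
  differences of monomials with the same image.\<close>

section \<open>Congruence of monomials modulo an ideal\<close>

definition mon_cong ::
    "(('v \<Rightarrow>\<^sub>0 'e::comm_monoid_add) \<Rightarrow>\<^sub>0 'k::comm_ring_1) set \<Rightarrow> ('v \<Rightarrow>\<^sub>0 'e) \<Rightarrow> ('v \<Rightarrow>\<^sub>0 'e) \<Rightarrow> bool"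
  where "mon_cong I m n \<longleftrightarrow> Poly_Mapping.single m 1 - Poly_Mapping.single n 1 \<in> I"

text \<open>Moves the closure laws from the ring structure to the operations of the type, where
  \<open>simp\<close> can calculate.\<close>

lemma ideal_mpoly_ring:
  assumes "ideal I (mpoly_ring V)"
  shows "0 \<in> I"
    and "\<lbrakk>p \<in> I; q \<in> I\<rbrakk> \<Longrightarrow> p + q \<in> I"
    and "\<lbrakk>p \<in> I; q \<in> carrier (mpoly_ring V)\<rbrakk> \<Longrightarrow> q * p \<in> I"
    and "p \<in> I \<Longrightarrow> - p \<in> I"
proof -
  interpret ideal I "mpoly_ring V" by fact
  show "0 \<in> I" using additive_subgroup.zero_closed[OF is_additive_subgroup] by simp
  show "p + q \<in> I" if "p \<in> I" "q \<in> I" using additive_subgroup.a_closed[OF is_additive_subgroup that] by simp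
  show l: "q * p \<in> I" if "p \<in> I" "q \<in> carrier (mpoly_ring V)" for p q
    using I_l_closed[OF that] by simp
  have "- 1 \<in> carrier (mpoly_ring V)"
    by simp
  then show "- p \<in> I" if "p \<in> I"
    using l[OF that, of "- 1"] by simp
qed

lemma mon_cong_refl: "ideal I (mpoly_ring V) \<Longrightarrow> mon_cong I m m"
  by (simp add: mon_cong_def ideal_mpoly_ring)

lemma mon_cong_sym:
  assumes "ideal I (mpoly_ring V)" "mon_cong I m n"
  shows "mon_cong I n m"
  using ideal_mpoly_ring(4)[OF assms(1)] assms(2) unfolding mon_cong_def by fastforce

lemma mon_cong_trans:
  assumes "ideal I (mpoly_ring V)" "mon_cong I l m" "mon_cong I m n"
  shows "mon_cong I l n"
  using ideal_mpoly_ring(2)[OF assms(1)] assms(2,3) unfolding mon_cong_def by fastforce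

text \<open>The difference of products telescopes as
  \<open>x^m' (x^m - x^n) + x^n (x^m' - x^n')\<close>. The conditions on keys put the two
  multipliers \<open>x^m'\<close> and \<open>x^n\<close> into the ring.\<close>

lemma mon_cong_add:
  fixes I :: "(('v \<Rightarrow>\<^sub>0 'e::comm_monoid_add) \<Rightarrow>\<^sub>0 'k::comm_ring_1) set"
  assumes I: "ideal I (mpoly_ring V)" and "mon_cong I m n" "mon_cong I m' n'"
    and keys: "Poly_Mapping.keys n \<subseteq> V" "Poly_Mapping.keys m' \<subseteq> V"
  shows "mon_cong I (m + m') (n + n')"
proof -
  let ?M = "\<lambda>m. Poly_Mapping.single m 1 :: ('v \<Rightarrow>\<^sub>0 'e) \<Rightarrow>\<^sub>0 'k"
  have "?M m' * (?M m - ?M n) + ?M n * (?M m' - ?M n') \<in> I"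
    using assms by (intro ideal_mpoly_ring(2,3)[OF I]) (simp_all add: mon_cong_def)
  also have "?M m' * (?M m - ?M n) + ?M n * (?M m' - ?M n') = ?M (m + m') - ?M (n + n')"
    by (simp add: right_diff_distrib mult_single add.commute)
  finally show ?thesis
    by (simp add: mon_cong_def)
qed

text \<open>The product \<open>(x^m - x^n) x^w\<close> lies in the prime ideal and its second factor
  does not. This is where the primality of \<open>I_ideal P\<close> takes effect in the forward
  direction.\<close>

lemma mon_cong_cancel:
  fixes I :: "(('v \<Rightarrow>\<^sub>0 'e::comm_monoid_add) \<Rightarrow>\<^sub>0 'k::comm_ring_1) set"
  assumes "primeideal I (mpoly_ring V)" "Poly_Mapping.single w 1 \<notin> I" "mon_cong I (m + w) (n + w)"
    and "Poly_Mapping.keys m \<subseteq> V" "Poly_Mapping.keys n \<subseteq> V" "Poly_Mapping.keys w \<subseteq> V"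
  shows "mon_cong I m n"
proof -
  interpret primeideal I "mpoly_ring V" by fact
  let ?M = "\<lambda>m. Poly_Mapping.single m 1 :: ('v \<Rightarrow>\<^sub>0 'e) \<Rightarrow>\<^sub>0 'k"
  have "(?M m - ?M n) * ?M w \<in> I"
    using assms(3) by (simp add: mon_cong_def left_diff_distrib mult_single)
  moreover have "?M m - ?M n \<in> carrier (mpoly_ring V)"
    using assms(4,5) by (intro mpoly_ring_closed(4)) simp_all
  moreover have "?M w \<in> carrier (mpoly_ring V)"
    using assms(6) by simp
  ultimately show ?thesis
    using I_prime[of "?M m - ?M n" "?M w"] assms(2)
    unfolding mon_cong_def mpoly_ring_simps(2) by blast
qed

subsection \<open>Images of monomials\<close>

text \<open>The additive map on exponent vectors that underlies \<psi>. A multiple of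
  \<open>u_exp P a\<close> is a repeated sum, mirroring the repeated product in a power of
  \<open>u P a\<close>.\<close>

definition mon_exp :: "point set set \<Rightarrow> (point \<Rightarrow>\<^sub>0 nat) \<Rightarrow> (point \<Rightarrow>\<^sub>0 int)" where
  "mon_exp P m = (\<Sum>a\<in>Poly_Mapping.keys m. \<Sum>i<Poly_Mapping.lookup m a. u_exp P a)"

lemma u_power: "u P a ^ n = Poly_Mapping.single (\<Sum>i<n. u_exp P a) 1"
  by (induction n) (simp_all add: u_def mult_single add.commute)

lemma prod_single:
  fixes f :: "'a \<Rightarrow> 'e::comm_monoid_add"
  shows "(\<Prod>a\<in>A. Poly_Mapping.single (f a) 1) =
    (Poly_Mapping.single (\<Sum>a\<in>A. f a) 1 :: 'e \<Rightarrow>\<^sub>0 'k::comm_semiring_1)"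
  by (induction A rule: infinite_finite_induct) (simp_all add: mult_single)

lemma psi_monomial: "psi P (Poly_Mapping.single m c) = Poly_Mapping.single (mon_exp P m) c"
  by (simp add: psi_single u_power prod_single mon_exp_def mult_single)

lemma single_one_eq_iff:
  "Poly_Mapping.single m (1::'k::zero_neq_one) = Poly_Mapping.single n 1 \<longleftrightarrow> m = n"
  by (metis keys_single singleton_inject zero_neq_one)

lemma mon_exp_add: "mon_exp P (m + n) = mon_exp P m + mon_exp P n"
proof -
  let ?A = "Poly_Mapping.keys m \<union> Poly_Mapping.keys n"
  have *: "mon_exp P k = (\<Sum>a\<in>?A. \<Sum>i<Poly_Mapping.lookup k a. u_exp P a)"
    if "Poly_Mapping.keys k \<subseteq> ?A" for k
    unfolding mon_exp_def using that by (intro sum.mono_neutral_left) (auto simp: in_keys_iff)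
  have **: "(\<Sum>i<x + y. c) = (\<Sum>i<x. c) + (\<Sum>i<y. c)"
    for c :: "point \<Rightarrow>\<^sub>0 int" and x y :: nat
    by (induction y) (simp_all add: add.assoc)
  show ?thesis
    using keys_add[of m n] by (simp add: * lookup_add ** sum.distrib)
qed

text \<open>At a free vertex the recursion for \<open>u_exp\<close> stops at a unit vector, so on
  free monomials \<psi> merely reads exponents as integers.\<close>

lemma lookup_mon_exp_free:
  assumes "Poly_Mapping.keys m \<subseteq> free_vertices P"
  shows "Poly_Mapping.lookup (mon_exp P m) a = int (Poly_Mapping.lookup m a)"
proof -
  have "u_exp P b = Poly_Mapping.single b 1" if "b \<in> Poly_Mapping.keys m" for b
  proof -
    have "cell b \<notin> P"
      using that assms by (auto simp: free_vertices_def)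
    then show ?thesis
      using u_exp.simps[of P "fst b" "snd b"] by simp
  qed
  then have "Poly_Mapping.lookup (mon_exp P m) a =
      (\<Sum>b\<in>Poly_Mapping.keys m. if b = a then int (Poly_Mapping.lookup m a) else 0)"
    unfolding mon_exp_def lookup_sum
    by (intro sum.cong refl) (simp add: lookup_single when_def)
  then show ?thesis
    by (simp add: in_keys_iff)
qed

lemma mon_exp_free_inj:
  assumes "Poly_Mapping.keys m \<subseteq> free_vertices P" "Poly_Mapping.keys n \<subseteq> free_vertices P"
    and "mon_exp P m = mon_exp P n"
  shows "m = n"
  using assms lookup_mon_exp_free[of m P] lookup_mon_exp_free[of n P]
  by (metis poly_mapping_eqI of_nat_eq_iff)

subsection \<open>The kernel of \<open>\<psi>\<close>\<close>

lemma L_ideal_iff: "p \<in> L_ideal P \<longleftrightarrow> p \<in> carrier (S_ring P) \<and> psi P p = 0"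
  unfolding L_ideal_def a_kernel_def' by (simp only: mem_Collect_eq mpoly_ring_simps(4))

lemma psi_diff: "psi P (p - q) = psi P p - psi P q"
  using psi_add[of P "p - q" q] by (simp add: algebra_simps)

text \<open>The image is a Laurent monomial with coefficient 1, hence nonzero. This makes
  \<open>L_ideal P\<close> proper and later permits cancelling monomials.\<close>

lemma monomial_notin_L_ideal: "Poly_Mapping.single m 1 \<notin> L_ideal P"
  by (simp add: L_ideal_iff psi_monomial) (metis keys_single keys_zero insert_not_empty zero_neq_one)

lemma mon_cong_L_ideal_iff:
  "mon_cong (L_ideal P :: 'k::field mpoly set) m n \<longleftrightarrow> mon_exp P m = mon_exp P n"
  if "Poly_Mapping.keys m \<subseteq> vertices P" "Poly_Mapping.keys n \<subseteq> vertices P"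
proof -
  have "Poly_Mapping.single m 1 - Poly_Mapping.single n 1 \<in> carrier (S_ring P :: 'k mpoly ring)"
    using that by (intro mpoly_ring_closed(4)) simp_all
  then show ?thesis
    unfolding mon_cong_def L_ideal_iff
    by (simp only: psi_diff psi_monomial right_minus_eq single_one_eq_iff simp_thms)
qed

lemma primeideal_L_ideal:
  assumes "cell_collection P"
  shows "primeideal (L_ideal P :: 'k::field mpoly set) (S_ring P)"
proof (rule primeidealI)
  let ?S = "S_ring P :: 'k mpoly ring" and ?T = "T_ring P :: 'k laurent ring"
  have "ring ?S" "ring ?T"
    using cring_mpoly_ring cring_def by blast+
  then interpret ring_hom_ring ?S ?T "psi P"
    by (intro ring_hom_ringI2 psi_ring_hom assms)
  show "ideal (L_ideal P) ?S"
    unfolding L_ideal_def by (rule kernel_is_ideal)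
  show "cring ?S"
    by (rule cring_mpoly_ring)
  have "Poly_Mapping.single 0 1 \<in> carrier ?S"
    by simp
  then show "carrier ?S \<noteq> L_ideal P"
    using monomial_notin_L_ideal by blast
  fix p q
  assume pq: "p \<in> carrier ?S" "q \<in> carrier ?S" "p \<otimes>\<^bsub>?S\<^esub> q \<in> L_ideal P"
  then have "psi P p * psi P q = 0"
    unfolding L_ideal_iff by (simp only: psi_mult mpoly_ring_simps)
  \<comment> \<open>The Laurent polynomial type has no zero divisors because its exponent vectors
    form a linearly ordered group, by way of the lexicographic linear order on points.\<close>
  then show "p \<in> L_ideal P \<or> q \<in> L_ideal P"
    using pq(1,2) by (simp only: L_ideal_iff mult_eq_0_iff simp_thms)
qed

subsection \<open>The ideal of inner minors\<close>

text \<open>The recursion is this identity for one cell. Neighbouring cells combine to a strip of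
  height one, and strips to the interval; degenerate intervals start both inductions.\<close>

lemma u_exp_interval:
  assumes "finite P" "i \<le> k" "j \<le> l"
    and cells: "\<And>r s. \<lbrakk>i \<le> r; r < k; j \<le> s; s < l\<rbrakk> \<Longrightarrow> cell (r, s) \<in> P"
  shows "u_exp P (i, j) + u_exp P (k, l) = u_exp P (k, j) + u_exp P (i, l)"
proof -
  have "u_exp P (i, s) + u_exp P (k, s + 1) = u_exp P (k, s) + u_exp P (i, s + 1)"
    if s: "j \<le> s" "s < l" for s
    using assms(2) cells
  proof (induction k rule: dec_induct)
    case base
    show ?case by simp
  next
    case (step k)
    then have "u_exp P (i, s) + u_exp P (k, s + 1) = u_exp P (k, s) + u_exp P (i, s + 1)"
      by simp
    \<comment> \<open>The recursion at \<open>(k, s)\<close>, the cell by which the strip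
      grows.\<close>
    moreover have "u_exp P (k, s) = u_exp P (k + 1, s) + u_exp P (k, s + 1) - u_exp P (k + 1, s + 1)"
      using step s assms(1) by (subst u_exp.simps) simp
    ultimately show ?case
      by (simp add: algebra_simps)
  qed
  with assms(3) show ?thesis
  proof (induction l rule: dec_induct)
    case base
    show ?case by (simp add: add.commute)
  next
    case (step l)
    then have "u_exp P (i, j) = u_exp P (k, j) + u_exp P (i, l) - u_exp P (k, l)"
      by (simp add: eq_diff_eq)
    \<comment> \<open>The strip between the rows \<open>l\<close> and \<open>l + 1\<close>.\<close>
    moreover have "u_exp P (k, l + 1) = u_exp P (k, l) + u_exp P (i, l + 1) - u_exp P (i, l)"
      using step by (simp add: eq_diff_eq add.commute)
    ultimately show ?case
      by simp
  qed
qed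

lemma minor_in_L_ideal:
  assumes "cell_collection P" "inner_interval P a b"
  shows "minor a b \<in> L_ideal P"
proof -
  obtain i j k l where ab: "a = (i, j)" "b = (k, l)"
    by (metis surj_pair)
  have less: "i < k" "j < l"
    using assms(2) by (simp_all add: ab inner_interval_def proper_interval_def)
  have cells: "cell (r, s) \<in> P" if "i \<le> r" "r < k" "j \<le> s" "s < l" for r s
  proof -
    have "cell (r, s) \<in> cells_of_interval a b"
      unfolding cells_of_interval_def ab using that by fastforce
    then show ?thesis
      using assms(2) by (auto simp: inner_interval_def)
  qed
  \<comment> \<open>Each corner of the interval is a vertex of the cell in that corner, whence the
    predecessors of \<open>k\<close> and \<open>l\<close>.\<close>
  have "(i, j) \<in> vertices P" "(k, j) \<in> vertices P" "(i, l) \<in> vertices P" "(k, l) \<in> vertices P"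
    using vertices_cell[OF cells[of i j]] vertices_cell[OF cells[of "k - 1" j]]
      vertices_cell[OF cells[of i "l - 1"]] vertices_cell[OF cells[of "k - 1" "l - 1"]] less
    by simp_all
  then have "minor a b \<in> carrier (S_ring P)"
    unfolding minor_def by (intro mpoly_ring_closed) (simp_all add: var_def ab)
  moreover have "psi P (minor a b) = 0"
    using u_exp_interval[of P i k j l] cells less assms(1)
    by (simp add: minor_def psi_diff psi_mult psi_var u_def mult_single ab cell_collection_def)
  ultimately show ?thesis
    by (simp only: L_ideal_iff simp_thms)
qed

text \<open>The laws for generated ideals ask for generators in the carrier. The minors lie in S
  because they lie in \<open>L_ideal P\<close>, which also gives the inclusion by
  minimality.\<close>

lemma
  assumes "cell_collection P"
  shows ideal_I_ideal: "ideal (I_ideal P :: 'k::field mpoly set) (S_ring P)"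
    and I_ideal_subset_L_ideal: "(I_ideal P :: 'k mpoly set) \<subseteq> L_ideal P"
    and minor_in_I_ideal: "inner_interval P a b \<Longrightarrow> minor a b \<in> (I_ideal P :: 'k mpoly set)"
proof -
  interpret primeideal "L_ideal P :: 'k mpoly set" "S_ring P"
    using primeideal_L_ideal[OF assms] .
  have sub: "{minor a b | a b. inner_interval P a b} \<subseteq> (L_ideal P :: 'k mpoly set)"
    using minor_in_L_ideal[OF assms] by blast
  show "(I_ideal P :: 'k mpoly set) \<subseteq> L_ideal P"
    unfolding I_ideal_def by (rule genideal_minimal[OF is_ideal sub])
  have car: "{minor a b | a b. inner_interval P a b} \<subseteq> carrier (S_ring P :: 'k mpoly ring)"
    using sub a_subset by blast
  show "ideal (I_ideal P :: 'k mpoly set) (S_ring P)"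
    unfolding I_ideal_def by (rule genideal_ideal[OF car])
  show "minor a b \<in> (I_ideal P :: 'k mpoly set)" if "inner_interval P a b"
    unfolding I_ideal_def using genideal_self[OF car] that by blast
qed

text \<open>A cell is the only cell of its own interval, so its minor is a generator. Modulo the
  ideal it plays the part of the recursion for \<open>u\<close>.\<close>

lemma cell_relation:
  assumes "cell_collection P" "cell (i, j) \<in> P"
  shows "mon_cong (I_ideal P :: 'k::field mpoly set)
    (Poly_Mapping.single (i, j) 1 + Poly_Mapping.single (i + 1, j + 1) 1)
    (Poly_Mapping.single (i + 1, j) 1 + Poly_Mapping.single (i, j + 1) 1)"
proof -
  have "cells_of_interval (i, j) (i + 1, j + 1) \<subseteq> P"
    using assms(2) by (auto simp: cells_of_interval_def le_antisym)
  then have "inner_interval P (i, j) (i + 1, j + 1)"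
    by (simp add: inner_interval_def proper_interval_def)
  from minor_in_I_ideal[OF assms(1) this, where 'k = 'k] show ?thesis
    by (simp add: mon_cong_def minor_def var_def mult_single)
qed

section \<open>Reduction to monomials in the free variables\<close>

text \<open>Expresses \<open>x^m\<close> as the fraction \<open>x^p / x^q\<close> modulo the ideal,
  with the denominator cleared. The type argument fixes the field, which exponent vectors do not
  show.\<close>

definition free_reducible ::
    "('k::field) itself \<Rightarrow> point set set \<Rightarrow> (point \<Rightarrow>\<^sub>0 nat) \<Rightarrow> bool" where
  "free_reducible _ P m \<longleftrightarrow> (\<exists>p q. Poly_Mapping.keys p \<subseteq> free_vertices P \<and>
     Poly_Mapping.keys q \<subseteq> free_vertices P \<and> mon_cong (I_ideal P :: 'k mpoly set) (m + q) p)"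

lemma free_vertices_subset: "free_vertices P \<subseteq> vertices P"
  by (auto simp: free_vertices_def)

lemma keys_add_subset:
  fixes m n :: "'v \<Rightarrow>\<^sub>0 'e::monoid_add"
  shows "\<lbrakk>Poly_Mapping.keys m \<subseteq> V; Poly_Mapping.keys n \<subseteq> V\<rbrakk> \<Longrightarrow> Poly_Mapping.keys (m + n) \<subseteq> V"
  using keys_add[of m n] by blast

text \<open>The fractions \<open>p / q\<close> and \<open>p' / q'\<close> are multiplied. The
  condition on \<open>n\<close> makes \<open>n + q'\<close> a legitimate multiplier in
  \<open>mon_cong_add\<close>.\<close>

lemma free_reducible_add:
  assumes "cell_collection P" "free_reducible TYPE('k::field) P m" "free_reducible TYPE('k) P n"
    and "Poly_Mapping.keys n \<subseteq> vertices P"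
  shows "free_reducible TYPE('k) P (m + n)"
proof -
  obtain p q p' q' where
    pq: "Poly_Mapping.keys p \<subseteq> free_vertices P" "Poly_Mapping.keys q \<subseteq> free_vertices P"
      "mon_cong (I_ideal P :: 'k mpoly set) (m + q) p"
    and pq': "Poly_Mapping.keys p' \<subseteq> free_vertices P" "Poly_Mapping.keys q' \<subseteq> free_vertices P"
      "mon_cong (I_ideal P :: 'k mpoly set) (n + q') p'"
    using assms(2,3) unfolding free_reducible_def by blast
  have "mon_cong (I_ideal P :: 'k mpoly set) ((m + q) + (n + q')) (p + p')"
    using free_vertices_subset[of P] pq pq' assms(4)
    by (intro mon_cong_add[OF ideal_I_ideal[OF assms(1)]] keys_add_subset) auto
  then have "mon_cong (I_ideal P :: 'k mpoly set) ((m + n) + (q + q')) (p + p')"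
    by (simp add: ac_simps)
  then show ?thesis
    using pq pq' keys_add_subset unfolding free_reducible_def by metis
qed

text \<open>Induction along the recursion for \<open>u_exp\<close>. Let \<open>a = (i, j)\<close>,
  \<open>b = (i + 1, j)\<close>, \<open>c = (i, j + 1)\<close>, \<open>d = (i + 1, j + 1)\<close>.
  If \<open>x_b x_c\<close> is \<open>p' / q'\<close> and \<open>x_d\<close> is
  \<open>p / q\<close>, the cell relation between \<open>x_a x_d\<close> and \<open>x_b x_c\<close>
  turns \<open>x_a\<close> into \<open>p' q / (q' p)\<close>.\<close>

lemma free_reducible_var:
  assumes "cell_collection P" "a \<in> vertices P"
  shows "free_reducible TYPE('k::field) P (Poly_Mapping.single a 1)"
  using assms
proof (induction P a rule: u_exp.induct)
  case (1 P i j)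
  note ideal = ideal_I_ideal[OF 1(4), where 'k = 'k]
  show ?case
  proof (cases "cell (i, j) \<in> P")
    case True
    let ?x = "\<lambda>a. Poly_Mapping.single a 1 :: point \<Rightarrow>\<^sub>0 nat"
    let ?I = "I_ideal P :: 'k mpoly set"
    have fin: "finite P"
      using 1(4) by (simp add: cell_collection_def)
    note V = vertices_cell[OF True]
    have bc: "free_reducible TYPE('k) P (?x (i + 1, j) + ?x (i, j + 1))"
      using 1 V True fin by (intro free_reducible_add) simp_all
    have "free_reducible TYPE('k) P (?x (i + 1, j + 1))"
      using 1 V True fin by simp
    then obtain p q where
      pq: "Poly_Mapping.keys p \<subseteq> free_vertices P" "Poly_Mapping.keys q \<subseteq> free_vertices P"
        "mon_cong ?I (?x (i + 1, j + 1) + q) p"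
      unfolding free_reducible_def by blast
    obtain p' q' where
      pq': "Poly_Mapping.keys p' \<subseteq> free_vertices P" "Poly_Mapping.keys q' \<subseteq> free_vertices P"
        "mon_cong ?I (?x (i + 1, j) + ?x (i, j + 1) + q') p'"
      using bc unfolding free_reducible_def by blast
    note keys = pq(1,2) pq'(1,2) free_vertices_subset[of P]
    \<comment> \<open>Expanding \<open>p\<close> to \<open>x_d q\<close> puts \<open>x_d\<close>
      next to \<open>x_a\<close>, so that the cell relation applies.\<close>
    have "mon_cong ?I (?x (i, j) + q' + p) (?x (i, j) + q' + (?x (i + 1, j + 1) + q))"
      using keys V
      by (intro mon_cong_add[OF ideal] mon_cong_refl[OF ideal] mon_cong_sym[OF ideal pq(3)] keys_add_subset)
        auto
    then have red_d: "mon_cong ?I (?x (i, j) + (q' + p)) (?x (i, j) + ?x (i + 1, j + 1) + (q' + q))"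
      by (simp only: ac_simps)
    have red_a: "mon_cong ?I (?x (i, j) + ?x (i + 1, j + 1) + (q' + q))
        (?x (i + 1, j) + ?x (i, j + 1) + (q' + q))"
      using keys V
      by (intro mon_cong_add[OF ideal] cell_relation[OF 1(4) True] mon_cong_refl[OF ideal] keys_add_subset)
        auto
    have "mon_cong ?I (?x (i + 1, j) + ?x (i, j + 1) + q' + q) (p' + q)"
      using keys V
      by (intro mon_cong_add[OF ideal] pq' mon_cong_refl[OF ideal] keys_add_subset) auto
    then have "mon_cong ?I (?x (i + 1, j) + ?x (i, j + 1) + (q' + q)) (p' + q)"
      by (simp only: add.assoc)
    then have "mon_cong ?I (?x (i, j) + (q' + p)) (p' + q)"
      by (rule mon_cong_trans[OF ideal mon_cong_trans[OF ideal red_d red_a]])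
    then show ?thesis
      using keys keys_add_subset unfolding free_reducible_def by metis
  next
    case False
    then have "(i, j) \<in> free_vertices P"
      using 1(5) by (auto simp: free_vertices_def)
    \<comment> \<open>A free variable is its own numerator, with denominator 1.\<close>
    then show ?thesis
      unfolding free_reducible_def using mon_cong_refl[OF ideal]
      by (intro exI[of _ "Poly_Mapping.single (i, j) 1"] exI[of _ 0]) simp
  qed
qed

text \<open>Induction on the total degree: one variable of \<open>m\<close> is split off at a
  time.\<close>

lemma monomial_induct [consumes 1, case_names zero add]:
  fixes m :: "'v \<Rightarrow>\<^sub>0 nat"
  assumes "Poly_Mapping.keys m \<subseteq> V" and zero: "R 0"
    and add: "\<And>m a. \<lbrakk>Poly_Mapping.keys m \<subseteq> V; R m; a \<in> V\<rbrakk> \<Longrightarrow> R (m + Poly_Mapping.single a 1)"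
  shows "R m"
  using assms(1)
proof (induction "\<Sum>a\<in>Poly_Mapping.keys m. Poly_Mapping.lookup m a" arbitrary: m rule: less_induct)
  case less
  show ?case
  proof (cases "m = 0")
    case False
    then obtain a where a: "a \<in> Poly_Mapping.keys m"
      by (metis all_not_in_conv keys_eq_empty)
    define n where "n = m - Poly_Mapping.single a 1"
    have lookup_n: "Poly_Mapping.lookup n b = Poly_Mapping.lookup m b - (if b = a then 1 else 0)" for b
      by (simp add: n_def lookup_minus lookup_single when_def)
    \<comment> \<open>The subtraction is not truncated, since \<open>a\<close> occurs in
      \<open>m\<close>.\<close>
    have m: "m = n + Poly_Mapping.single a 1"
      using a by (intro poly_mapping_eqI) (auto simp: lookup_add lookup_n lookup_single when_def in_keys_iff)
    have keys: "Poly_Mapping.keys n \<subseteq> Poly_Mapping.keys m"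
      by (auto simp: in_keys_iff lookup_n)
    \<comment> \<open>As \<open>a\<close> may have left the support, both degrees are summed over
      the keys of \<open>m\<close>.\<close>
    then have "(\<Sum>b\<in>Poly_Mapping.keys n. Poly_Mapping.lookup n b) =
        (\<Sum>b\<in>Poly_Mapping.keys m. Poly_Mapping.lookup n b)"
      by (intro sum.mono_neutral_left) (auto simp: in_keys_iff)
    also have "\<dots> < (\<Sum>b\<in>Poly_Mapping.keys m. Poly_Mapping.lookup m b)"
      using a by (intro sum_strict_mono_ex1) (auto simp: lookup_n in_keys_iff)
    finally have "R n"
      using less keys by blast
    then show ?thesis
      using less.prems a keys m add[of n a] by auto
  qed (simp add: zero)
qed

lemma free_reducible:
  assumes "cell_collection P" "Poly_Mapping.keys m \<subseteq> vertices P"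
  shows "free_reducible TYPE('k::field) P m"
  using assms(2)
proof (induction rule: monomial_induct)
  case zero
  show ?case
    unfolding free_reducible_def using mon_cong_refl[OF ideal_I_ideal[OF assms(1)]]
    by (intro exI[of _ 0]) simp
next
  case (add m a)
  then show ?case
    by (intro free_reducible_add free_reducible_var assms(1)) simp_all
qed

section \<open>The kernel inside a prime ideal of minors\<close>

text \<open>Write the two monomials as fractions \<open>p / q\<close> and \<open>p' / q'\<close> in
  free variables. Equal images give \<open>p q' = p' q\<close>, so the monomials become congruent
  after multiplication with \<open>q q'\<close>, which is then cancelled.\<close>

lemma mon_cong_I_ideal:
  assumes P: "cell_collection P" and prime: "primeideal (I_ideal P :: 'k::field mpoly set) (S_ring P)"
    and keys: "Poly_Mapping.keys m \<subseteq> vertices P" "Poly_Mapping.keys n \<subseteq> vertices P"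
    and eq: "mon_exp P m = mon_exp P n"
  shows "mon_cong (I_ideal P :: 'k mpoly set) m n"
proof -
  let ?I = "I_ideal P :: 'k mpoly set"
  note ideal = ideal_I_ideal[OF P, where 'k = 'k]
  obtain p q where
    pq: "Poly_Mapping.keys p \<subseteq> free_vertices P" "Poly_Mapping.keys q \<subseteq> free_vertices P"
      "mon_cong ?I (m + q) p"
    using free_reducible[OF P keys(1), where 'k = 'k] unfolding free_reducible_def by blast
  obtain p' q' where
    pq': "Poly_Mapping.keys p' \<subseteq> free_vertices P" "Poly_Mapping.keys q' \<subseteq> free_vertices P"
      "mon_cong ?I (n + q') p'"
    using free_reducible[OF P keys(2), where 'k = 'k] unfolding free_reducible_def by blast
  note free = pq(1,2) pq'(1,2)
  note vert = free[THEN subset_trans[OF _ free_vertices_subset]]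
  \<comment> \<open>A congruence modulo \<open>I_ideal P\<close> also holds modulo
    \<open>L_ideal P\<close>, so it preserves images under \<psi>.\<close>
  have exp: "mon_exp P k + mon_exp P k' = mon_exp P k''"
    if "mon_cong ?I (k + k') k''" "Poly_Mapping.keys k \<subseteq> vertices P"
      "Poly_Mapping.keys k' \<subseteq> vertices P" "Poly_Mapping.keys k'' \<subseteq> vertices P" for k k' k''
  proof -
    have "mon_cong (L_ideal P :: 'k mpoly set) (k + k') k''"
      using that(1) I_ideal_subset_L_ideal[OF P] by (auto simp: mon_cong_def)
    then show ?thesis
      using that(2-4) by (simp add: mon_cong_L_ideal_iff keys_add_subset mon_exp_add)
  qed
  have "mon_exp P (p + q') = mon_exp P (p' + q)"
    using exp[OF pq(3)] exp[OF pq'(3)] keys vert eq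
    by (simp add: mon_exp_add) (metis add.assoc add.commute)
  \<comment> \<open>Free monomials are determined by their images, so this is an equality of
    monomials and not just a congruence.\<close>
  then have same: "p + q' = p' + q"
    using free by (intro mon_exp_free_inj[of _ P] keys_add_subset)
  have "mon_cong ?I (m + q + q') (p + q')"
    using vert by (intro mon_cong_add[OF ideal] pq mon_cong_refl[OF ideal])
  moreover have "mon_cong ?I (p' + q) (n + q' + q)"
    using vert keys
    by (intro mon_cong_add[OF ideal] mon_cong_sym[OF ideal pq'(3)] mon_cong_refl[OF ideal] keys_add_subset)
  ultimately have "mon_cong ?I (m + q + q') (n + q' + q)"
    unfolding same by (rule mon_cong_trans[OF ideal])
  then have "mon_cong ?I (m + (q + q')) (n + (q + q'))"
    by (simp only: ac_simps)
  moreover have "Poly_Mapping.single (q + q') 1 \<notin> ?I"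
    using I_ideal_subset_L_ideal[OF P] monomial_notin_L_ideal by blast
  ultimately show ?thesis
    using keys vert by (intro mon_cong_cancel[OF prime, of "q + q'" m n] keys_add_subset)
qed

lemma ideal_sum:
  assumes "ideal I (mpoly_ring V)" "\<And>x. x \<in> A \<Longrightarrow> f x \<in> I"
  shows "sum f A \<in> I"
  using assms(2)
  by (induction A rule: infinite_finite_induct) (simp_all add: ideal_mpoly_ring[OF assms(1)])

text \<open>Choose a representative \<open>r(e)\<close> among the monomials with image \<open>e\<close>. Then \<open>p\<close> is the sum
  of the terms \<open>c\<^sub>m (x^m - x^r(e))\<close> with \<open>e\<close> the image of \<open>m\<close>, because the coefficients of
  \<open>p\<close> over each image \<open>e\<close> sum up to the coefficient of \<open>\<psi>(p) = 0\<close> at \<open>e\<close>.\<close>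

lemma L_ideal_subset_I_ideal:
  assumes P: "cell_collection P" and prime: "primeideal (I_ideal P :: 'k::field mpoly set) (S_ring P)"
  shows "(L_ideal P :: 'k mpoly set) \<subseteq> I_ideal P"
proof
  fix p :: "'k mpoly"
  assume "p \<in> L_ideal P"
  then have car: "\<And>m. m \<in> Poly_Mapping.keys p \<Longrightarrow> Poly_Mapping.keys m \<subseteq> vertices P"
    and psi: "psi P p = 0"
    by (simp_all add: L_ideal_iff)
  let ?K = "Poly_Mapping.keys p" and ?c = "Poly_Mapping.lookup p" and ?U = "mon_exp P"
  let ?M = "\<lambda>m. Poly_Mapping.single m 1 :: 'k mpoly"
  \<comment> \<open>Choosing within the support of \<open>p\<close> keeps \<open>x^r(e)\<close> in S
    for every image \<open>e\<close> of a monomial of \<open>p\<close>.\<close>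
  define r where "r e = (SOME m. m \<in> ?K \<and> ?U m = e)" for e
  have r: "r (?U m) \<in> ?K \<and> ?U (r (?U m)) = ?U m" if "m \<in> ?K" for m
    unfolding r_def by (rule someI[where x = m]) (use that in simp)
  have fibre: "(\<Sum>m | m \<in> ?K \<and> ?U m = e. ?c m) = 0" for e
  proof -
    have "0 = Poly_Mapping.lookup (psi P (\<Sum>m\<in>?K. Poly_Mapping.single m (?c m))) e"
      by (simp add: psi flip: sum_single_keys)
    also have "\<dots> = (\<Sum>m\<in>?K. if ?U m = e then ?c m else 0)"
      by (simp add: psi_sum psi_monomial lookup_sum lookup_single when_def)
    also have "\<dots> = (\<Sum>m | m \<in> ?K \<and> ?U m = e. ?c m)"
      by (rule sum.inter_filter[symmetric]) simp
    finally show ?thesis by simp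
  qed
  \<comment> \<open>The subtracted terms must sum to zero. Grouped by image, each group shares the
    factor \<open>x^r(e)\<close>, and its coefficients sum to zero by \<open>fibre\<close>.\<close>
  have "(\<Sum>m\<in>?K. const (?c m) * ?M (r (?U m))) =
      (\<Sum>e\<in>?U ` ?K. \<Sum>m | m \<in> ?K \<and> ?U m = e. const (?c m) * ?M (r (?U m)))"
    by (simp add: sum.image_gen[of ?K _ ?U])
  also have "\<dots> = (\<Sum>e\<in>?U ` ?K. const (\<Sum>m | m \<in> ?K \<and> ?U m = e. ?c m) * ?M (r e))"
  proof (rule sum.cong[OF refl])
    fix e
    have const_sum: "const (sum ?c A) = (\<Sum>m\<in>A. const (?c m) :: 'k mpoly)" for A
      by (induction A rule: infinite_finite_induct) (simp_all add: single_add)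
    show "(\<Sum>m | m \<in> ?K \<and> ?U m = e. const (?c m) * ?M (r (?U m))) =
        const (\<Sum>m | m \<in> ?K \<and> ?U m = e. ?c m) * ?M (r e)"
      by (simp add: const_sum sum_distrib_right)
  qed
  also have "\<dots> = 0"
    by (simp add: fibre)
  finally have "p = (\<Sum>m\<in>?K. const (?c m) * (?M m - ?M (r (?U m))))"
    using sum_single_keys[of p] by (simp add: right_diff_distrib sum_subtractf mult_single)
  also have "\<dots> \<in> I_ideal P"
  proof (rule ideal_sum[OF ideal_I_ideal[OF P]])
    fix m
    assume m: "m \<in> ?K"
    then have "?M m - ?M (r (?U m)) \<in> I_ideal P"
      using mon_cong_I_ideal[OF P prime, of m "r (?U m)"] r[OF m] car by (simp add: mon_cong_def)
    then show "const (?c m) * (?M m - ?M (r (?U m))) \<in> I_ideal P"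
      by (rule ideal_mpoly_ring(3)[OF ideal_I_ideal[OF P]]) simp
  qed
  finally show "p \<in> I_ideal P" .
qed

theorem corollary3p6:
  fixes P :: "point set set"
  assumes "cell_collection P"
  shows "primeideal (I_ideal P :: 'k::field mpoly set) (S_ring P)
     \<longleftrightarrow> (I_ideal P :: 'k mpoly set) = L_ideal P"
proof
  assume "primeideal (I_ideal P :: 'k mpoly set) (S_ring P)"
  then show "(I_ideal P :: 'k mpoly set) = L_ideal P"
    using I_ideal_subset_L_ideal[OF assms] L_ideal_subset_I_ideal[OF assms] by blast
next
  assume "(I_ideal P :: 'k mpoly set) = L_ideal P"
  then show "primeideal (I_ideal P :: 'k mpoly set) (S_ring P)"
    using primeideal_L_ideal[OF assms, where 'k = 'k] by simp
qed

end
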